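(* Let $\mathcal V$ be a variety. Suppose that in every algebra $\mathbf A\in\mathcal V$ the inclusion $$\alpha(\beta\circ\Theta)\subseteq \alpha\beta\circ\alpha\Theta\circ\alpha\beta$$ holds for all congruences $\alpha,\beta$ of $\mathbf A$ and every tolerance $\Theta$ on $\mathbf A$. Then $\mathcal V$ has a majority term. In fact, it is enough to assume that this inclusion holds (for all congruences $\alpha,\beta$ and every tolerance $\Theta$) in the single algebra $\mathbf F_{\mathcal V}(3)$, the free algebra in $\mathcal V$ generated by $3$ elements.
   Context: A binary relation on (the universe of) an algebra $\mathbf A$ is admissible if it is compatible with all operations, i.e. it is a subalgebra of $\mathbf A\times\mathbf A$. A tolerance is a reflexive, symmetric, admissible binary relation. Juxtaposition of relations denotes intersection and binds more tightly than relational composition $\circ$, where $a\,(S\circ T)\,c$ iff there is $b$ with $a\,S\,b\,T\,c$. A majority term for $\mathcal V$ is a ternary term $m$ such that the equations $m(x,x,z)=x$, $m(x,y,x)=x$ and $m(x,z,z)=z$ hold in $\mathcal V$. *)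

theory Defs
  imports Main
begin

text \<open>
  Universal algebra over a finitary signature. The operation symbols form a set rather than a
  whole type, so that the empty signature is included.
\<close>

record 'f signature =
  symbols :: "'f set"
  arity :: "'f \<Rightarrow> nat"

record ('f, 'a) algebra =
  universe :: "'a set"
  oper :: "'f \<Rightarrow> 'a list \<Rightarrow> 'a"

text \<open>Algebras have a nonempty universe.\<close>

definition is_algebra :: "'f signature \<Rightarrow> ('f, 'a) algebra \<Rightarrow> bool" where
  "is_algebra Sg A \<longleftrightarrow> universe A \<noteq> {} \<and>
     (\<forall>f\<in>symbols Sg. \<forall>xs. length xs = arity Sg f \<longrightarrow> set xs \<subseteq> universe A \<longrightarrow>
        oper A f xs \<in> universe A)"

definition admissible :: "'f signature \<Rightarrow> ('f, 'a) algebra \<Rightarrow> ('a \<times> 'a) set \<Rightarrow> bool" where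
  "admissible Sg A R \<longleftrightarrow> R \<subseteq> universe A \<times> universe A \<and>
     (\<forall>f\<in>symbols Sg. \<forall>xs ys. length xs = arity Sg f \<longrightarrow> list_all2 (\<lambda>x y. (x, y) \<in> R) xs ys \<longrightarrow>
        (oper A f xs, oper A f ys) \<in> R)"

definition tolerance :: "'f signature \<Rightarrow> ('f, 'a) algebra \<Rightarrow> ('a \<times> 'a) set \<Rightarrow> bool" where
  "tolerance Sg A R \<longleftrightarrow> refl_on (universe A) R \<and> sym R \<and> admissible Sg A R"

definition congruence :: "'f signature \<Rightarrow> ('f, 'a) algebra \<Rightarrow> ('a \<times> 'a) set \<Rightarrow> bool" where
  "congruence Sg A R \<longleftrightarrow> equiv (universe A) R \<and> admissible Sg A R"

definition tolerance_inclusion :: "'f signature \<Rightarrow> ('f, 'a) algebra \<Rightarrow> bool" where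
  "tolerance_inclusion Sg A \<longleftrightarrow>
     (\<forall>\<alpha> \<beta> \<Theta>. congruence Sg A \<alpha> \<longrightarrow> congruence Sg A \<beta> \<longrightarrow> tolerance Sg A \<Theta> \<longrightarrow>
        \<alpha> \<inter> (\<beta> O \<Theta>) \<subseteq> (\<alpha> \<inter> \<beta>) O (\<alpha> \<inter> \<Theta>) O (\<alpha> \<inter> \<beta>))"

datatype ('f, 'v) trm = Var 'v | App 'f "('f, 'v) trm list"

inductive_set terms :: "'f signature \<Rightarrow> 'v set \<Rightarrow> ('f, 'v) trm set"
  for Sg :: "'f signature" and X :: "'v set" where
  Var: "x \<in> X \<Longrightarrow> Var x \<in> terms Sg X"
| App: "f \<in> symbols Sg \<Longrightarrow> length ts = arity Sg f \<Longrightarrow> \<forall>t\<in>set ts. t \<in> terms Sg X \<Longrightarrow>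
          App f ts \<in> terms Sg X"

primrec eval :: "('f, 'a) algebra \<Rightarrow> ('v \<Rightarrow> 'a) \<Rightarrow> ('f, 'v) trm \<Rightarrow> 'a" where
  "eval A \<rho> (Var x) = \<rho> x"
| "eval A \<rho> (App f ts) = oper A f (map (eval A \<rho>) ts)"

primrec subst :: "('v \<Rightarrow> ('f, 'w) trm) \<Rightarrow> ('f, 'v) trm \<Rightarrow> ('f, 'w) trm" where
  "subst \<sigma> (Var x) = \<sigma> x"
| "subst \<sigma> (App f ts) = App f (map (subst \<sigma>) ts)"

definition satisfies ::
  "('f, 'a) algebra \<Rightarrow> ('f, 'v) trm \<Rightarrow> ('f, 'v) trm \<Rightarrow> bool" where
  "satisfies A s t \<longleftrightarrow> (\<forall>\<rho>. range \<rho> \<subseteq> universe A \<longrightarrow> eval A \<rho> s = eval A \<rho> t)"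

text \<open>
  A variety is the class of all algebras, over carriers of any type, that satisfy a given set
  \<open>E\<close> of identities in countably many variables.
\<close>

definition identities ::
  "'f signature \<Rightarrow> (('f, nat) trm \<times> ('f, nat) trm) set \<Rightarrow> bool" where
  "identities Sg E \<longleftrightarrow> E \<subseteq> terms Sg UNIV \<times> terms Sg UNIV"

definition in_variety ::
  "'f signature \<Rightarrow> (('f, nat) trm \<times> ('f, nat) trm) set \<Rightarrow> ('f, 'a) algebra \<Rightarrow> bool" where
  "in_variety Sg E A \<longleftrightarrow> is_algebra Sg A \<and> (\<forall>(s, t)\<in>E. satisfies A s t)"

text \<open>
  A single formula can only quantify over algebras on one carrier type. Sets of terms form a type
  that is large enough for testing identities: by \<open>holds_in_variety_satisfies\<close> below, an identity
  that holds in all members of the variety on this type holds in all members on every type.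
  The free algebras with at most countably many generators also live on this type.
\<close>

definition holds_in_variety ::
  "'f signature \<Rightarrow> (('f, nat) trm \<times> ('f, nat) trm) set \<Rightarrow>
     ('f, nat) trm \<Rightarrow> ('f, nat) trm \<Rightarrow> bool" where
  "holds_in_variety Sg E s t \<longleftrightarrow>
     (\<forall>A :: ('f, ('f, nat) trm set) algebra. in_variety Sg E A \<longrightarrow> satisfies A s t)"

text \<open>The algebra freely generated in the variety by \<open>X\<close>: terms modulo the identities of the variety.\<close>

definition free_cong ::
  "'f signature \<Rightarrow> (('f, nat) trm \<times> ('f, nat) trm) set \<Rightarrow> nat set \<Rightarrow>
     (('f, nat) trm \<times> ('f, nat) trm) set" where
  "free_cong Sg E X =
     {(s, t). s \<in> terms Sg X \<and> t \<in> terms Sg X \<and> holds_in_variety Sg E s t}"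

definition free_algebra ::
  "'f signature \<Rightarrow> (('f, nat) trm \<times> ('f, nat) trm) set \<Rightarrow> nat set \<Rightarrow>
     ('f, ('f, nat) trm set) algebra" where
  "free_algebra Sg E X =
     \<lparr>universe = terms Sg X // free_cong Sg E X,
      oper = (\<lambda>f Cs. free_cong Sg E X `` {App f (map (\<lambda>C. SOME t. t \<in> C) Cs)})\<rparr>"

text \<open>The substitution instance \<open>m(p, q, r)\<close> of a term \<open>m\<close> in the variables 0, 1, 2.\<close>

definition subst3 ::
  "('f, nat) trm \<Rightarrow> ('f, nat) trm \<Rightarrow> ('f, nat) trm \<Rightarrow> ('f, nat) trm \<Rightarrow> ('f, nat) trm" where
  "subst3 m p q r = subst (\<lambda>i. if i = 0 then p else if i = 1 then q else r) m"

definition majority_term ::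
  "'f signature \<Rightarrow> (('f, nat) trm \<times> ('f, nat) trm) set \<Rightarrow> ('f, nat) trm \<Rightarrow> bool" where
  "majority_term Sg E m \<longleftrightarrow> m \<in> terms Sg {0, 1, 2} \<and>
     (let x = Var 0; y = Var 1; z = Var 2 in
        holds_in_variety Sg E (subst3 m x x z) x \<and>
        holds_in_variety Sg E (subst3 m x y x) x \<and>
        holds_in_variety Sg E (subst3 m x z z) z)"


subsection \<open>Adequacy of the carrier type and of the free algebra\<close>

lemma eval_subst: "eval A \<rho> (subst \<sigma> t) = eval A (\<lambda>x. eval A \<rho> (\<sigma> x)) t"
  by (induction t) (auto simp: comp_def cong: map_cong)

lemma eval_closed:
  assumes "is_algebra Sg A" "\<And>x. x \<in> X \<Longrightarrow> \<rho> x \<in> universe A" "t \<in> terms Sg X"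
  shows "eval A \<rho> t \<in> universe A"
  using assms(3)
proof induction
  case (Var x)
  then show ?case using assms(2) by simp
next
  case (App f ts)
  then have "set (map (eval A \<rho>) ts) \<subseteq> universe A" by auto
  with App assms(1) show ?case by (auto simp: is_algebra_def)
qed

lemma subst_closed:
  assumes "\<And>x. x \<in> X \<Longrightarrow> \<sigma> x \<in> terms Sg Y" "t \<in> terms Sg X"
  shows "subst \<sigma> t \<in> terms Sg Y"
  using assms(2) by induction (auto intro!: terms.App simp: assms(1))

lemma holds_in_variety_satisfies:
  fixes B :: "('f, 'b) algebra"
  assumes E: "identities Sg E" and st: "s \<in> terms Sg UNIV" "t \<in> terms Sg UNIV"
    and h: "holds_in_variety Sg E s t" and B: "in_variety Sg E B"
  shows "satisfies B s t"
  unfolding satisfies_def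
proof (intro allI impI)
  fix \<rho> :: "nat \<Rightarrow> 'b" assume \<rho>: "range \<rho> \<subseteq> universe B"
  have algB: "is_algebra Sg B" using B by (simp add: in_variety_def)
  let ?T = "terms Sg (UNIV :: nat set)"
  define S where "S = eval B \<rho> ` ?T"
  define j where "j b = {u \<in> ?T. eval B \<rho> u = b}" for b
  define k where "k = inv_into S j"
  have inj: "inj_on j S"
    unfolding inj_on_def S_def j_def by blast
  have kj: "k (j b) = b" if "b \<in> S" for b
    using that inj by (simp add: k_def)
  have SB: "S \<subseteq> universe B"
    unfolding S_def using eval_closed[OF algB, of UNIV \<rho>] \<rho> by auto
  have S_op: "oper B f bs \<in> S"
    if "f \<in> symbols Sg" "length bs = arity Sg f" "set bs \<subseteq> S" for f bs
  proof -
    have "\<forall>b\<in>S. \<exists>u\<in>?T. eval B \<rho> u = b" by (auto simp: S_def)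
    then obtain g where g: "\<And>b. b \<in> S \<Longrightarrow> g b \<in> ?T \<and> eval B \<rho> (g b) = b" by metis
    have "App f (map g bs) \<in> ?T" using that g by (auto intro!: terms.App simp: subset_iff)
    moreover have "map (eval B \<rho> \<circ> g) bs = bs"
      using that g by (intro map_idI) auto
    then have "eval B \<rho> (App f (map g bs)) = oper B f bs" by simp
    ultimately show ?thesis unfolding S_def by (metis imageI)
  qed
  define C :: "('f, ('f, nat) trm set) algebra" where
    "C = \<lparr>universe = j ` S, oper = (\<lambda>f xs. j (oper B f (map k xs)))\<rparr>"
  have kS: "k x \<in> S" if "x \<in> j ` S" for x using that kj by auto
  have S_ne: "\<rho> 0 \<in> S"
    unfolding S_def by (rule image_eqI[of _ _ "Var 0"]) (auto intro: terms.Var)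
  have algC: "is_algebra Sg C"
    unfolding is_algebra_def
  proof (intro conjI ballI allI impI)
    show "universe C \<noteq> {}" using S_ne by (auto simp: C_def)
    fix f xs assume f: "f \<in> symbols Sg" "length xs = arity Sg f" "set xs \<subseteq> universe C"
    then have "oper B f (map k xs) \<in> S" using kS by (intro S_op) (auto simp: C_def)
    then show "oper C f xs \<in> universe C" by (simp add: C_def)
  qed
  have ev: "eval C \<sigma> u = j (eval B (\<lambda>x. k (\<sigma> x)) u) \<and> eval B (\<lambda>x. k (\<sigma> x)) u \<in> S"
    if \<sigma>: "range \<sigma> \<subseteq> universe C" and u: "u \<in> ?T" for \<sigma> u
    using u
  proof induction
    case (Var x)
    have "\<sigma> x \<in> j ` S" using \<sigma> by (auto simp: C_def)
    then show ?case using kj by auto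
  next
    case (App f us)
    have "map k (map (eval C \<sigma>) us) = map (eval B (\<lambda>x. k (\<sigma> x))) us"
      using App kj by (auto simp: comp_def)
    moreover have "set (map (eval B (\<lambda>x. k (\<sigma> x))) us) \<subseteq> S" using App by auto
    then have "oper B f (map (eval B (\<lambda>x. k (\<sigma> x))) us) \<in> S" using App S_op by simp
    moreover have "oper C f xs = j (oper B f (map k xs))" for xs by (simp add: C_def)
    ultimately show ?case by (simp del: map_map)
  qed
  have "in_variety Sg E C"
    unfolding in_variety_def
  proof (intro conjI algC ballI, clarify)
    fix p q assume pq: "(p, q) \<in> E"
    then have T: "p \<in> ?T" "q \<in> ?T" using E by (auto simp: identities_def)
    have sat: "satisfies B p q" using B pq by (auto simp: in_variety_def)
    show "satisfies C p q"
      unfolding satisfies_def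
    proof (intro allI impI)
      fix \<sigma> :: "nat \<Rightarrow> ('f, nat) trm set" assume \<sigma>: "range \<sigma> \<subseteq> universe C"
      have "k (\<sigma> x) \<in> universe B" for x
      proof -
        have "\<sigma> x \<in> j ` S" using \<sigma> unfolding C_def by auto
        then show ?thesis using kS SB by blast
      qed
      then have "range (\<lambda>x. k (\<sigma> x)) \<subseteq> universe B" by blast
      then have "eval B (\<lambda>x. k (\<sigma> x)) p = eval B (\<lambda>x. k (\<sigma> x)) q"
        using sat by (simp add: satisfies_def)
      then show "eval C \<sigma> p = eval C \<sigma> q" using ev[OF \<sigma>] T by simp
    qed
  qed
  then have sat: "satisfies C s t" using h by (simp add: holds_in_variety_def)
  have \<rho>S: "\<rho> x \<in> S" for x
    unfolding S_def by (rule image_eqI[of _ _ "Var x"]) (auto intro: terms.Var)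
  define \<sigma> where "\<sigma> = j \<circ> \<rho>"
  have \<sigma>: "range \<sigma> \<subseteq> universe C" using \<rho>S by (auto simp: C_def \<sigma>_def)
  have "(\<lambda>x. k (\<sigma> x)) = \<rho>" using kj \<rho>S by (auto simp: \<sigma>_def)
  moreover have "eval C \<sigma> s = eval C \<sigma> t" using sat \<sigma> by (simp add: satisfies_def)
  ultimately have "j (eval B \<rho> s) = j (eval B \<rho> t)" "eval B \<rho> s \<in> S" "eval B \<rho> t \<in> S"
    using ev[OF \<sigma> st(1)] ev[OF \<sigma> st(2)] by simp_all
  then show "eval B \<rho> s = eval B \<rho> t" by (rule inj_onD[OF inj])
qed

lemma terms_mono: "t \<in> terms Sg X \<Longrightarrow> X \<subseteq> Y \<Longrightarrow> t \<in> terms Sg Y"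
  by (induction rule: terms.induct) (auto intro!: terms.intros)

lemma equiv_free_cong: "equiv (terms Sg X) (free_cong Sg E X)"
  by (rule equivI)
    (auto simp: free_cong_def holds_in_variety_def satisfies_def refl_on_def sym_def trans_def)

lemma free_rep:
  assumes "C \<in> universe (free_algebra Sg E X)"
  shows "(SOME t. t \<in> C) \<in> terms Sg X"
    and "free_cong Sg E X `` {SOME t. t \<in> C} = C"
proof -
  have C: "C \<in> terms Sg X // free_cong Sg E X" using assms by (simp add: free_algebra_def)
  then have "C \<noteq> {}" using in_quotient_imp_non_empty[OF equiv_free_cong] by blast
  then have in_C: "(SOME t. t \<in> C) \<in> C" by (simp add: some_in_eq)
  then show "(SOME t. t \<in> C) \<in> terms Sg X"
    using in_quotient_imp_subset[OF equiv_free_cong C] by blast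
  show "free_cong Sg E X `` {SOME t. t \<in> C} = C"
    by (rule quotientE[OF C]) (use in_C in \<open>metis Image_singleton_iff equiv_class_eq equiv_free_cong\<close>)
qed

lemma free_cong_App:
  assumes f: "f \<in> symbols Sg" and l: "length ss = arity Sg f"
    and r: "list_all2 (\<lambda>s t. (s, t) \<in> free_cong Sg E X) ss ts"
  shows "(App f ss, App f ts) \<in> free_cong Sg E X"
proof -
  have "App f ss \<in> terms Sg X" "App f ts \<in> terms Sg X"
    using f l r
    by (auto intro!: terms.App simp: free_cong_def list_all2_conv_all_nth in_set_conv_nth)
  moreover have "holds_in_variety Sg E (App f ss) (App f ts)"
    unfolding holds_in_variety_def satisfies_def
  proof (intro allI impI)
    fix A :: "('a, ('a, nat) trm set) algebra" and \<rho> :: "nat \<Rightarrow> ('a, nat) trm set"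
    assume "in_variety Sg E A" "range \<rho> \<subseteq> universe A"
    then have "map (eval A \<rho>) ss = map (eval A \<rho>) ts"
      using r by (auto intro!: nth_equalityI
          simp: free_cong_def holds_in_variety_def satisfies_def list_all2_conv_all_nth)
    then show "eval A \<rho> (App f ss) = eval A \<rho> (App f ts)" by simp
  qed
  ultimately show ?thesis by (simp add: free_cong_def)
qed

lemma eval_free_algebra:
  assumes \<sigma>: "\<And>x. x \<in> Y \<Longrightarrow> \<sigma> x \<in> terms Sg X" and t: "t \<in> terms Sg Y"
  shows "eval (free_algebra Sg E X) (\<lambda>x. free_cong Sg E X `` {\<sigma> x}) t =
    free_cong Sg E X `` {subst \<sigma> t}"
  using t
proof induction
  case (Var x)
  then show ?case by simp
next
  case (App f ts)
  let ?c = "\<lambda>t. free_cong Sg E X `` {t}"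
  let ?rep = "\<lambda>C. SOME t. t \<in> C"
  have rel: "(?rep (?c (subst \<sigma> t)), subst \<sigma> t) \<in> free_cong Sg E X" if "t \<in> set ts" for t
  proof -
    have T: "subst \<sigma> t \<in> terms Sg X"
      by (rule subst_closed[of Y]) (use \<sigma> App that in auto)
    then have U: "?c (subst \<sigma> t) \<in> universe (free_algebra Sg E X)"
      by (simp add: free_algebra_def quotientI)
    show ?thesis
      using free_rep[OF U] T equiv_free_cong by (metis eq_equiv_class)
  qed
  have "(App f (map (\<lambda>t. ?rep (?c (subst \<sigma> t))) ts), App f (map (subst \<sigma>) ts)) \<in> free_cong Sg E X"
    using App rel by (intro free_cong_App) (auto simp: list_all2_conv_all_nth)
  then have "?c (App f (map (\<lambda>t. ?rep (?c (subst \<sigma> t))) ts)) = ?c (App f (map (subst \<sigma>) ts))"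
    using equiv_free_cong equiv_class_eq by metis
  moreover have "map (eval (free_algebra Sg E X) (\<lambda>x. ?c (\<sigma> x))) ts = map (\<lambda>t. ?c (subst \<sigma> t)) ts"
    using App by auto
  moreover have "oper (free_algebra Sg E X) f Cs = ?c (App f (map ?rep Cs))" for Cs
    by (simp add: free_algebra_def)
  ultimately have "oper (free_algebra Sg E X) f
      (map (eval (free_algebra Sg E X) (\<lambda>x. ?c (\<sigma> x))) ts) = ?c (App f (map (subst \<sigma>) ts))"
    by (simp only: map_map comp_def)
  then show ?case by simp
qed

lemma free_algebra_in_variety:
  assumes E: "identities Sg E" and X: "X \<noteq> {}"
  shows "in_variety Sg E (free_algebra Sg E X)"
  unfolding in_variety_def
proof (intro conjI ballI, goal_cases)
  case 1
  have "terms Sg X \<noteq> {}" using X by (auto intro: terms.Var)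
  moreover have "App f (map (\<lambda>C. SOME t. t \<in> C) Cs) \<in> terms Sg X"
    if "f \<in> symbols Sg" "length Cs = arity Sg f" "set Cs \<subseteq> universe (free_algebra Sg E X)" for f Cs
    using that free_rep(1) by (fastforce intro!: terms.App)
  ultimately show ?case
    unfolding is_algebra_def by (simp add: free_algebra_def quotientI)
next
  case (2 e)
  obtain p q where e: "e = (p, q)" and pq: "(p, q) \<in> E" using 2 by (cases e) auto
  have T: "p \<in> terms Sg UNIV" "q \<in> terms Sg UNIV" using E pq by (auto simp: identities_def)
  have "satisfies (free_algebra Sg E X) p q"
    unfolding satisfies_def
  proof (intro allI impI)
    fix \<rho> :: "nat \<Rightarrow> ('a, nat) trm set"
    assume \<rho>: "range \<rho> \<subseteq> universe (free_algebra Sg E X)"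
    define \<sigma> where "\<sigma> x = (SOME t. t \<in> \<rho> x)" for x
    have U: "\<rho> x \<in> universe (free_algebra Sg E X)" for x using \<rho> by auto
    have \<sigma>: "\<sigma> x \<in> terms Sg X" "free_cong Sg E X `` {\<sigma> x} = \<rho> x" for x
      using free_rep[OF U[of x]] by (simp_all add: \<sigma>_def)
    have ev: "eval (free_algebra Sg E X) \<rho> u = free_cong Sg E X `` {subst \<sigma> u}"
      if "u \<in> terms Sg UNIV" for u
      using eval_free_algebra[of UNIV \<sigma> Sg X u E] \<sigma> that by simp
    have "holds_in_variety Sg E (subst \<sigma> p) (subst \<sigma> q)"
      unfolding holds_in_variety_def satisfies_def eval_subst
    proof (intro allI impI)
      fix A :: "('a, ('a, nat) trm set) algebra" and \<tau> :: "nat \<Rightarrow> ('a, nat) trm set"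
      assume A: "in_variety Sg E A" and \<tau>: "range \<tau> \<subseteq> universe A"
      have "eval A \<tau> (\<sigma> x) \<in> universe A" for x
        using eval_closed[of Sg A X \<tau> "\<sigma> x"] A \<tau> \<sigma>(1) by (auto simp: in_variety_def)
      then show "eval A (\<lambda>x. eval A \<tau> (\<sigma> x)) p = eval A (\<lambda>x. eval A \<tau> (\<sigma> x)) q"
        using A pq by (fastforce simp: in_variety_def satisfies_def)
    qed
    then have "(subst \<sigma> p, subst \<sigma> q) \<in> free_cong Sg E X"
      using subst_closed[of UNIV \<sigma> Sg X] \<sigma>(1) T by (simp add: free_cong_def)
    then show "eval (free_algebra Sg E X) \<rho> p = eval (free_algebra Sg E X) \<rho> q"
      using ev T equiv_class_eq[OF equiv_free_cong] by metis
  qed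
  then show ?case by (simp add: e)
qed

lemma free_algebra_universal:
  fixes B :: "('f, 'b) algebra"
  assumes E: "identities Sg E" and B: "in_variety Sg E B" and \<rho>: "\<And>x. x \<in> X \<Longrightarrow> \<rho> x \<in> universe B"
  obtains h where
    "\<And>C. C \<in> universe (free_algebra Sg E X) \<Longrightarrow> h C \<in> universe B"
    "\<And>x. x \<in> X \<Longrightarrow> h (free_cong Sg E X `` {Var x}) = \<rho> x"
    "\<And>f Cs. f \<in> symbols Sg \<Longrightarrow> length Cs = arity Sg f \<Longrightarrow>
       set Cs \<subseteq> universe (free_algebra Sg E X) \<Longrightarrow>
       h (oper (free_algebra Sg E X) f Cs) = oper B f (map h Cs)"
proof -
  have algB: "is_algebra Sg B" using B by (simp add: in_variety_def)
  then obtain b where b: "b \<in> universe B" by (auto simp: is_algebra_def)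
  define \<rho>' where "\<rho>' x = (if x \<in> X then \<rho> x else b)" for x
  have \<rho>': "\<rho>' x \<in> universe B" for x using \<rho> b by (simp add: \<rho>'_def)
  define h where "h C = eval B \<rho>' (SOME t. t \<in> C)" for C
  have hc: "h (free_cong Sg E X `` {t}) = eval B \<rho>' t" if t: "t \<in> terms Sg X" for t
  proof -
    have U: "free_cong Sg E X `` {t} \<in> universe (free_algebra Sg E X)"
      using t by (simp add: free_algebra_def quotientI)
    let ?r = "SOME u. u \<in> free_cong Sg E X `` {t}"
    have "(?r, t) \<in> free_cong Sg E X"
      using free_rep[OF U] t equiv_free_cong by (metis eq_equiv_class)
    then have "holds_in_variety Sg E ?r t" "?r \<in> terms Sg UNIV" "t \<in> terms Sg UNIV"
      by (auto simp: free_cong_def intro: terms_mono)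
    then have "satisfies B ?r t" using holds_in_variety_satisfies E B by blast
    then show ?thesis using \<rho>' by (auto simp: h_def satisfies_def)
  qed
  show thesis
  proof
    show "h C \<in> universe B" if "C \<in> universe (free_algebra Sg E X)" for C
      using eval_closed[OF algB _ free_rep(1)[OF that]] \<rho>' by (simp add: h_def)
    show "h (free_cong Sg E X `` {Var x}) = \<rho> x" if "x \<in> X" for x
      using that by (subst hc) (auto simp: \<rho>'_def intro: terms.Var)
    fix f Cs
    assume f: "f \<in> symbols Sg" "length Cs = arity Sg f"
      "set Cs \<subseteq> universe (free_algebra Sg E X)"
    have "App f (map (\<lambda>C. SOME t. t \<in> C) Cs) \<in> terms Sg X"
      using f free_rep(1) by (fastforce intro!: terms.App)
    from hc[OF this] show "h (oper (free_algebra Sg E X) f Cs) = oper B f (map h Cs)"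
      by (simp add: free_algebra_def comp_def h_def[abs_def])
  qed
qed

end

theory Submission
  imports Defs
begin

text \<open>
  Let \<open>x, y, z\<close> generate the free algebra. Apply the inclusion to the most general situation
  \<open>x \<beta> y \<Theta> z\<close>, \<open>x \<alpha> z\<close>: \<open>\<alpha>\<close> is the kernel of the endomorphism that sends \<open>z\<close> to \<open>x\<close>, \<open>\<beta>\<close> the
  kernel of the endomorphism that sends \<open>y\<close> to \<open>x\<close>, and \<open>\<Theta>\<close> the tolerance generated by \<open>(y, z)\<close>.
  Every pair in \<open>\<Theta>\<close> has the form \<open>(t(x,y,z,y,z), t(x,y,z,z,y))\<close> for a 5-ary term \<open>t\<close>: the first
  three places absorb the reflexive pairs, the last two the generating pair and its converse.
  The inclusion therefore yields a term \<open>t\<close> with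
  \<open>x \<alpha>\<beta> t(x,y,z,y,z)\<close> and \<open>t(x,y,z,z,y) \<alpha>\<beta> z\<close>, which means that the variety satisfies

    \<open>t(x,y,x,y,x) = x\<close>, \<open>t(x,x,z,x,z) = x\<close>, \<open>t(x,y,x,x,y) = x\<close>, \<open>t(x,x,z,z,x) = z\<close>.

  It remains to compose a majority term from \<open>t\<close>. Put \<open>p(x,y,z) = t(x,y,z,y,z)\<close> and
  \<open>q(x,y,z) = t(x,y,z,z,y)\<close>. The identities say that \<open>p(x,y,x) = p(x,x,z) = q(x,y,x) = x\<close> and
  \<open>q(x,x,z) = z\<close>, and by definition \<open>p(x,z,z) = q(x,z,z)\<close>, an element on which they give no further
  information. The term

    \<open>m(x,y,z) = t(p(x,z,y), q(x,y,z), y, z, q(x,z,y))\<close>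

  is a majority term, because the unknown element enters only in places where the last identity
  for \<open>t\<close> discards it:

    \<open>m(x,x,z) = t(x,z,x,z,x) = x\<close>,

    \<open>m(x,y,x) = t(x,x,y,x,y) = x\<close>,

    \<open>m(x,z,z) = t(r,r,z,z,r) = z\<close> where \<open>r = p(x,z,z) = q(x,z,z)\<close>.
\<close>

section \<open>Substitution and congruence classes of terms\<close>

lemma subst_subst: "subst \<sigma> (subst \<tau> t) = subst (\<lambda>i. subst \<sigma> (\<tau> i)) t"
  by (induction t) auto

lemma subst_cong_on:
  assumes "t \<in> terms Sg X" "\<And>i. i \<in> X \<Longrightarrow> \<sigma> i = \<tau> i"
  shows "subst \<sigma> t = subst \<tau> t"
  using assms(1) by induction (auto simp: assms(2))

lemma subst_Var: "subst Var t = t"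
  by (induction t) (auto intro: map_idI)

lemma holds_in_variety_subst:
  assumes st: "holds_in_variety Sg E s t" and \<sigma>: "\<And>i. \<sigma> i \<in> terms Sg UNIV"
  shows "holds_in_variety Sg E (subst \<sigma> s) (subst \<sigma> t)"
  unfolding holds_in_variety_def satisfies_def eval_subst
proof (intro allI impI)
  fix A :: "('a, ('a, nat) trm set) algebra" and \<rho> :: "nat \<Rightarrow> ('a, nat) trm set"
  assume A: "in_variety Sg E A" and \<rho>: "range \<rho> \<subseteq> universe A"
  have "eval A \<rho> (\<sigma> i) \<in> universe A" for i
    using eval_closed[of Sg A UNIV \<rho> "\<sigma> i"] A \<rho> \<sigma> by (auto simp: in_variety_def)
  then show "eval A (\<lambda>i. eval A \<rho> (\<sigma> i)) s = eval A (\<lambda>i. eval A \<rho> (\<sigma> i)) t"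
    using st A by (simp add: holds_in_variety_def satisfies_def image_subset_iff)
qed

abbreviation free_class ::
  "'f signature \<Rightarrow> (('f, nat) trm \<times> ('f, nat) trm) set \<Rightarrow> nat set \<Rightarrow>
     ('f, nat) trm \<Rightarrow> ('f, nat) trm set" where
  "free_class Sg E X t \<equiv> free_cong Sg E X `` {t}"

lemma free_class_eq_iff:
  assumes "s \<in> terms Sg X" "t \<in> terms Sg X"
  shows "free_class Sg E X s = free_class Sg E X t \<longleftrightarrow> holds_in_variety Sg E s t"
  using assms eq_equiv_class_iff[OF equiv_free_cong, of s Sg X t E] by (simp add: free_cong_def)

lemma universe_free_algebra:
  "universe (free_algebra Sg E X) = free_class Sg E X ` terms Sg X"
  by (auto simp: free_algebra_def quotient_def)

text \<open>
  The operations of the free algebra are defined through chosen representatives; this says that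
  any representatives may be used.
\<close>

lemma oper_free_class:
  assumes "f \<in> symbols Sg" "length ts = arity Sg f" "set ts \<subseteq> terms Sg X"
  shows "oper (free_algebra Sg E X) f (map (free_class Sg E X) ts) = free_class Sg E X (App f ts)"
proof -
  have ev: "eval (free_algebra Sg E X) (\<lambda>i. free_class Sg E X (Var i)) t = free_class Sg E X t"
    if "t \<in> terms Sg X" for t
    using eval_free_algebra[of X Var Sg X t E] that by (simp add: subst_Var terms.Var)
  have "App f ts \<in> terms Sg X" using assms by (auto intro: terms.App)
  from ev[OF this] have "oper (free_algebra Sg E X) f
      (map (eval (free_algebra Sg E X) (\<lambda>i. free_class Sg E X (Var i))) ts) =
      free_class Sg E X (App f ts)"
    by simp
  moreover have "map (eval (free_algebra Sg E X) (\<lambda>i. free_class Sg E X (Var i))) ts =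
      map (free_class Sg E X) ts"
    using assms(3) ev by auto
  ultimately show ?thesis by simp
qed

text \<open>
  Choosing parameters componentwise turns a relation given by parametrized pairs of terms into
  an admissible one as soon as the parameters can be combined under every operation symbol.
  Kernels and generated tolerances both have this form.
\<close>

lemma admissible_free_classI:
  assumes T: "\<And>w. w \<in> W \<Longrightarrow> l w \<in> terms Sg X \<and> r w \<in> terms Sg X"
    and comb: "\<And>f ws. f \<in> symbols Sg \<Longrightarrow> length ws = arity Sg f \<Longrightarrow> set ws \<subseteq> W \<Longrightarrow>
      \<exists>w\<in>W. l w = App f (map l ws) \<and> r w = App f (map r ws)"
  shows "admissible Sg (free_algebra Sg E X)
    ((\<lambda>w. (free_class Sg E X (l w), free_class Sg E X (r w))) ` W)"
    (is "admissible _ _ ?R")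
  unfolding admissible_def
proof (intro conjI ballI allI impI)
  show "?R \<subseteq> universe (free_algebra Sg E X) \<times> universe (free_algebra Sg E X)"
    using T by (auto simp: universe_free_algebra)
next
  fix f Cs Ds
  assume f: "f \<in> symbols Sg" and len: "length Cs = arity Sg f"
    and R: "list_all2 (\<lambda>C D. (C, D) \<in> ?R) Cs Ds"
  have "\<exists>ws. set ws \<subseteq> W \<and> Cs = map (\<lambda>w. free_class Sg E X (l w)) ws \<and>
      Ds = map (\<lambda>w. free_class Sg E X (r w)) ws"
    using R
  proof (induction rule: list_all2_induct)
    case Nil
    show ?case by simp
  next
    case (Cons C Cs D Ds)
    from Cons obtain w ws where "w \<in> W" "C = free_class Sg E X (l w)" "D = free_class Sg E X (r w)"
      "set ws \<subseteq> W" "Cs = map (\<lambda>w. free_class Sg E X (l w)) ws"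
      "Ds = map (\<lambda>w. free_class Sg E X (r w)) ws"
      by blast
    then show ?case by (intro exI[of _ "w # ws"]) simp
  qed
  then obtain ws where ws: "set ws \<subseteq> W"
    and Cs: "Cs = map (free_class Sg E X) (map l ws)"
    and Ds: "Ds = map (free_class Sg E X) (map r ws)"
    by (auto simp: comp_def)
  have len': "length ws = arity Sg f" using len Cs by simp
  from comb[OF f len' ws] obtain w where
    w: "w \<in> W" "l w = App f (map l ws)" "r w = App f (map r ws)" by blast
  have sub: "set (map l ws) \<subseteq> terms Sg X" "set (map r ws) \<subseteq> terms Sg X" using ws T by auto
  have "oper (free_algebra Sg E X) f Cs = free_class Sg E X (l w)"
    "oper (free_algebra Sg E X) f Ds = free_class Sg E X (r w)"
    unfolding Cs Ds w using f len' sub by (simp_all only: oper_free_class length_map)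
  with w(1) show "(oper (free_algebra Sg E X) f Cs, oper (free_algebra Sg E X) f Ds) \<in> ?R"
    by auto
qed

section \<open>Kernels of endomorphisms and generated tolerances\<close>

text \<open>
  The kernel of the endomorphism of the free algebra induced by a substitution of the generators.
\<close>

definition subst_kernel ::
  "'f signature \<Rightarrow> (('f, nat) trm \<times> ('f, nat) trm) set \<Rightarrow> nat set \<Rightarrow> (nat \<Rightarrow> ('f, nat) trm) \<Rightarrow>
     (('f, nat) trm set \<times> ('f, nat) trm set) set" where
  "subst_kernel Sg E X \<sigma> =
     (\<lambda>(s, t). (free_class Sg E X s, free_class Sg E X t)) `
       {(s, t). s \<in> terms Sg X \<and> t \<in> terms Sg X \<and> (subst \<sigma> s, subst \<sigma> t) \<in> free_cong Sg E X}"

text \<open>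
  Substitution preserves the identities of the variety, so membership in the kernel can be tested
  on any representatives.
\<close>

lemma subst_kernel_iff:
  assumes \<sigma>: "\<And>i. \<sigma> i \<in> terms Sg X" and s: "s \<in> terms Sg X" and t: "t \<in> terms Sg X"
  shows "(free_class Sg E X s, free_class Sg E X t) \<in> subst_kernel Sg E X \<sigma> \<longleftrightarrow>
    holds_in_variety Sg E (subst \<sigma> s) (subst \<sigma> t)"
proof -
  have \<sigma>T: "subst \<sigma> u \<in> terms Sg X" if "u \<in> terms Sg X" for u
    using subst_closed[OF \<sigma> that] .
  have "free_class Sg E X (subst \<sigma> u) = free_class Sg E X (subst \<sigma> v)"
    if "u \<in> terms Sg X" "v \<in> terms Sg X" "free_class Sg E X u = free_class Sg E X v" for u v
  proof -
    have "holds_in_variety Sg E u v" using that free_class_eq_iff by blast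
    then have "holds_in_variety Sg E (subst \<sigma> u) (subst \<sigma> v)"
      by (rule holds_in_variety_subst) (meson \<sigma> terms_mono subset_UNIV)
    then show ?thesis using free_class_eq_iff \<sigma>T that by blast
  qed
  note well_def = this
  have *: "(u, v) \<in> free_cong Sg E X \<longleftrightarrow> free_class Sg E X u = free_class Sg E X v"
    if "u \<in> terms Sg X" "v \<in> terms Sg X" for u v
    using free_class_eq_iff[OF that] that by (simp add: free_cong_def)
  have "(free_class Sg E X s, free_class Sg E X t) \<in> subst_kernel Sg E X \<sigma> \<longleftrightarrow>
      free_class Sg E X (subst \<sigma> s) = free_class Sg E X (subst \<sigma> t)"
  proof
    assume "(free_class Sg E X s, free_class Sg E X t) \<in> subst_kernel Sg E X \<sigma>"
    then obtain u v where uv: "u \<in> terms Sg X" "v \<in> terms Sg X"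
      "(subst \<sigma> u, subst \<sigma> v) \<in> free_cong Sg E X"
      "free_class Sg E X s = free_class Sg E X u" "free_class Sg E X t = free_class Sg E X v"
      by (auto simp: subst_kernel_def)
    then show "free_class Sg E X (subst \<sigma> s) = free_class Sg E X (subst \<sigma> t)"
      using well_def[of s u] well_def[of t v] *[of "subst \<sigma> u" "subst \<sigma> v"] \<sigma>T s t by simp
  next
    assume "free_class Sg E X (subst \<sigma> s) = free_class Sg E X (subst \<sigma> t)"
    then show "(free_class Sg E X s, free_class Sg E X t) \<in> subst_kernel Sg E X \<sigma>"
      unfolding subst_kernel_def using *[OF \<sigma>T[OF s] \<sigma>T[OF t]] s t
      by (intro image_eqI[of _ _ "(s, t)"]) simp_all
  qed
  then show ?thesis using free_class_eq_iff[OF \<sigma>T[OF s] \<sigma>T[OF t]] by simp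
qed

lemma congruence_subst_kernel:
  assumes \<sigma>: "\<And>i. \<sigma> i \<in> terms Sg X"
  shows "congruence Sg (free_algebra Sg E X) (subst_kernel Sg E X \<sigma>)"
  unfolding congruence_def
proof
  let ?K = "subst_kernel Sg E X \<sigma>" and ?c = "free_class Sg E X"
  note iff = subst_kernel_iff[of \<sigma>, OF \<sigma>]
  have sub: "\<exists>s\<in>terms Sg X. \<exists>t\<in>terms Sg X. C = ?c s \<and> D = ?c t" if "(C, D) \<in> ?K" for C D
    using that by (auto simp: subst_kernel_def)
  show "equiv (universe (free_algebra Sg E X)) ?K"
  proof (rule equivI)
    show "?K \<subseteq> universe (free_algebra Sg E X) \<times> universe (free_algebra Sg E X)"
      by (auto simp: subst_kernel_def universe_free_algebra)
    show "refl_on (universe (free_algebra Sg E X)) ?K"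
      by (auto simp: refl_on_def universe_free_algebra iff holds_in_variety_def satisfies_def)
    show "sym ?K"
      unfolding sym_def
    proof (intro allI impI)
      fix C D assume CD: "(C, D) \<in> ?K"
      then obtain s t where st: "s \<in> terms Sg X" "t \<in> terms Sg X" "C = ?c s" "D = ?c t"
        using sub by blast
      then show "(D, C) \<in> ?K"
        using CD by (auto simp: iff holds_in_variety_def satisfies_def)
    qed
    show "trans ?K"
      unfolding trans_def
    proof (intro allI impI)
      fix C D F assume CD: "(C, D) \<in> ?K" and DF: "(D, F) \<in> ?K"
      obtain s t where st: "s \<in> terms Sg X" "t \<in> terms Sg X" "C = ?c s" "D = ?c t"
        using sub CD by blast
      obtain u where u: "u \<in> terms Sg X" "F = ?c u"
        using sub DF by blast
      show "(C, F) \<in> ?K"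
        using CD DF st u by (auto simp: iff holds_in_variety_def satisfies_def)
    qed
  qed
  show "admissible Sg (free_algebra Sg E X) ?K"
    unfolding subst_kernel_def case_prod_unfold
  proof (rule admissible_free_classI, goal_cases)
    case (1 w)
    then show ?case by auto
  next
    case (2 f ws)
    have "(App f (map (subst \<sigma> \<circ> fst) ws), App f (map (subst \<sigma> \<circ> snd) ws)) \<in> free_cong Sg E X"
      using 2 by (intro free_cong_App) (auto simp: list_all2_conv_all_nth subset_iff)
    moreover have "App f (map fst ws) \<in> terms Sg X" "App f (map snd ws) \<in> terms Sg X"
      using 2 by (auto intro!: terms.App)
    ultimately show ?case
      by (intro bexI[of _ "(App f (map fst ws), App f (map snd ws))"]) (auto simp: comp_def)
  qed
qed

text \<open>
  The subalgebra of the square that is generated by the pairs \<open>(\<sigma> i, \<tau> i)\<close>, for \<open>i \<in> Y\<close>. It is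
  reflexive if the generators \<open>X\<close> occur on its diagonal, and symmetric if exchanging the two
  coordinates can be done by a substitution \<open>\<pi>\<close> of the variables in \<open>Y\<close>.
\<close>

definition generated_relation ::
  "'f signature \<Rightarrow> (('f, nat) trm \<times> ('f, nat) trm) set \<Rightarrow> nat set \<Rightarrow> nat set \<Rightarrow>
     (nat \<Rightarrow> ('f, nat) trm) \<Rightarrow> (nat \<Rightarrow> ('f, nat) trm) \<Rightarrow>
     (('f, nat) trm set \<times> ('f, nat) trm set) set" where
  "generated_relation Sg E X Y \<sigma> \<tau> =
     (\<lambda>t. (free_class Sg E X (subst \<sigma> t), free_class Sg E X (subst \<tau> t))) ` terms Sg Y"

lemma tolerance_generated_relation:
  assumes \<sigma>: "\<And>i. \<sigma> i \<in> terms Sg X" and \<tau>: "\<And>i. \<tau> i \<in> terms Sg X"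
    and \<delta>: "\<And>i. i \<in> X \<Longrightarrow> \<delta> i \<in> terms Sg Y \<and> subst \<sigma> (\<delta> i) = Var i \<and> subst \<tau> (\<delta> i) = Var i"
    and \<pi>: "\<And>i. \<pi> i \<in> terms Sg Y \<and> subst \<sigma> (\<pi> i) = \<tau> i \<and> subst \<tau> (\<pi> i) = \<sigma> i"
  shows "tolerance Sg (free_algebra Sg E X) (generated_relation Sg E X Y \<sigma> \<tau>)"
  unfolding tolerance_def
proof (intro conjI)
  let ?R = "generated_relation Sg E X Y \<sigma> \<tau>" and ?c = "free_class Sg E X"
  have "(?c s, ?c s) \<in> ?R" if s: "s \<in> terms Sg X" for s
  proof -
    have "subst \<sigma> (subst \<delta> s) = subst Var s" "subst \<tau> (subst \<delta> s) = subst Var s"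
      unfolding subst_subst by (rule subst_cong_on[OF s], simp add: \<delta>)+
    then have "subst \<sigma> (subst \<delta> s) = s" "subst \<tau> (subst \<delta> s) = s"
      by (simp_all add: subst_Var)
    moreover have "subst \<delta> s \<in> terms Sg Y"
      using \<delta> s by (blast intro: subst_closed)
    ultimately show ?thesis
      unfolding generated_relation_def by (intro image_eqI[of _ _ "subst \<delta> s"]) simp_all
  qed
  then show "refl_on (universe (free_algebra Sg E X)) ?R"
    by (auto simp: refl_on_def universe_free_algebra)
  have "(?c (subst \<tau> t), ?c (subst \<sigma> t)) \<in> ?R" if t: "t \<in> terms Sg Y" for t
  proof -
    have "subst \<pi> t \<in> terms Sg Y" using \<pi> t by (blast intro: subst_closed)
    moreover have "subst \<sigma> (subst \<pi> t) = subst \<tau> t" "subst \<tau> (subst \<pi> t) = subst \<sigma> t"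
      using \<pi> by (simp_all add: subst_subst)
    ultimately show ?thesis
      unfolding generated_relation_def by (intro image_eqI[of _ _ "subst \<pi> t"]) simp_all
  qed
  then show "sym ?R"
    by (auto simp: sym_def generated_relation_def)
  show "admissible Sg (free_algebra Sg E X) ?R"
    unfolding generated_relation_def
  proof (rule admissible_free_classI, goal_cases)
    case (1 t)
    then show ?case using \<sigma> \<tau> by (blast intro: subst_closed)
  next
    case (2 f ts)
    then have "App f ts \<in> terms Sg Y" by (auto intro: terms.App)
    then show ?case by (intro bexI[of _ "App f ts"]) auto
  qed
qed

section \<open>A 5-ary term from the tolerance inclusion\<close>

text \<open>
  Assignments to the variables \<open>0, 1, 2\<close> and \<open>0, 1, 2, 3, 4\<close>, used both for substituting terms and
  for evaluating in an algebra. Larger variables receive the last value, so that no assumption on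
  the variables of a term is needed to compare two such assignments.
\<close>

definition env3 :: "'a \<Rightarrow> 'a \<Rightarrow> 'a \<Rightarrow> nat \<Rightarrow> 'a" where
  "env3 a b c i = (if i = 0 then a else if i = 1 then b else c)"

definition env5 :: "'a \<Rightarrow> 'a \<Rightarrow> 'a \<Rightarrow> 'a \<Rightarrow> 'a \<Rightarrow> nat \<Rightarrow> 'a" where
  "env5 a b c d e i =
     (if i = 0 then a else if i = 1 then b else if i = 2 then c else if i = 3 then d else e)"

lemma eval_comp_env3:
  "(\<lambda>i. eval A \<rho> (env3 p q r i)) = env3 (eval A \<rho> p) (eval A \<rho> q) (eval A \<rho> r)"
  by (auto simp: env3_def)

lemma eval_comp_env5:
  "(\<lambda>i. eval A \<rho> (env5 p q r s w i)) =
     env5 (eval A \<rho> p) (eval A \<rho> q) (eval A \<rho> r) (eval A \<rho> s) (eval A \<rho> w)"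
  by (auto simp: env5_def)

lemma env5_in: "a \<in> U \<Longrightarrow> b \<in> U \<Longrightarrow> c \<in> U \<Longrightarrow> d \<in> U \<Longrightarrow> e \<in> U \<Longrightarrow> env5 a b c d e i \<in> U"
  by (simp add: env5_def)

lemma eval_subst3: "eval A \<rho> (subst3 m p q r) = eval A (env3 (eval A \<rho> p) (eval A \<rho> q) (eval A \<rho> r)) m"
  by (simp add: subst3_def eval_subst eval_comp_env3 flip: env3_def)

lemma eval_subst_env5:
  "eval A \<rho> (subst (env5 p q r s w) t) =
     eval A (env5 (eval A \<rho> p) (eval A \<rho> q) (eval A \<rho> r) (eval A \<rho> s) (eval A \<rho> w)) t"
  by (simp add: eval_subst eval_comp_env5)

text \<open>
  The four identities for \<open>t\<close>, read in an algebra: the first two say that \<open>t(x,y,z,y,z)\<close> is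
  \<open>\<alpha>\<beta>\<close>-related to \<open>x\<close>, the last two that \<open>t(x,y,z,z,y)\<close> is \<open>\<alpha>\<beta>\<close>-related to \<open>z\<close>.
\<close>

definition linking_identities :: "('f, 'a) algebra \<Rightarrow> ('f, nat) trm \<Rightarrow> bool" where
  "linking_identities A t \<longleftrightarrow> (\<forall>a\<in>universe A. \<forall>b\<in>universe A.
     eval A (env5 a b a b a) t = a \<and> eval A (env5 a a b a b) t = a \<and>
     eval A (env5 a b a a b) t = a \<and> eval A (env5 a a b b a) t = b)"

lemma linking_term_exists:
  fixes Sg :: "'f signature"
  assumes incl: "tolerance_inclusion Sg (free_algebra Sg E {0, 1, 2})"
  obtains t where "t \<in> terms Sg {..<5}"
    "\<And>A :: ('f, ('f, nat) trm set) algebra. in_variety Sg E A \<Longrightarrow> linking_identities A t"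
proof -
  let ?X = "{0, 1, 2} :: nat set" and ?Y = "{..<5} :: nat set"
  let ?c = "free_class Sg E ?X"
  define x y z :: "('f, nat) trm" where "x = Var 0" and "y = Var 1" and "z = Var 2"
  have xyz: "x \<in> terms Sg ?X" "y \<in> terms Sg ?X" "z \<in> terms Sg ?X"
    by (auto simp: x_def y_def z_def intro: terms.Var)
  define \<alpha> where "\<alpha> = subst_kernel Sg E ?X (env3 x y x)"
  define \<beta> where "\<beta> = subst_kernel Sg E ?X (env3 x x z)"
  let ?\<sigma> = "env5 x y z y z" and ?\<tau> = "env5 x y z z y"
  define \<Theta> where "\<Theta> = generated_relation Sg E ?X ?Y ?\<sigma> ?\<tau>"
  have T3: "env3 x y x i \<in> terms Sg ?X" "env3 x x z i \<in> terms Sg ?X" for i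
    using xyz by (simp_all add: env3_def)
  have T5: "?\<sigma> i \<in> terms Sg ?X" "?\<tau> i \<in> terms Sg ?X" for i
    using xyz by (simp_all add: env5_in)
  have \<alpha>_iff: "(?c s, ?c t) \<in> \<alpha> \<longleftrightarrow>
      holds_in_variety Sg E (subst (env3 x y x) s) (subst (env3 x y x) t)"
    if "s \<in> terms Sg ?X" "t \<in> terms Sg ?X" for s t
    unfolding \<alpha>_def using subst_kernel_iff[OF T3(1) that] .
  have \<beta>_iff: "(?c s, ?c t) \<in> \<beta> \<longleftrightarrow>
      holds_in_variety Sg E (subst (env3 x x z) s) (subst (env3 x x z) t)"
    if "s \<in> terms Sg ?X" "t \<in> terms Sg ?X" for s t
    unfolding \<beta>_def using subst_kernel_iff[OF T3(2) that] .
  have cong: "congruence Sg (free_algebra Sg E ?X) \<alpha>" "congruence Sg (free_algebra Sg E ?X) \<beta>"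
    unfolding \<alpha>_def \<beta>_def using T3 by (simp_all add: congruence_subst_kernel)
  have tol: "tolerance Sg (free_algebra Sg E ?X) \<Theta>"
    unfolding \<Theta>_def
  \<comment> \<open>Coordinates are exchanged by transposing the last two variables.\<close>
  proof (rule tolerance_generated_relation[where \<delta> = Var
        and \<pi> = "env5 (Var 0) (Var 1) (Var 2) (Var 4) (Var 3)"])
    show "?\<sigma> i \<in> terms Sg ?X" "?\<tau> i \<in> terms Sg ?X" for i using T5 .
    show "Var i \<in> terms Sg ?Y \<and> subst ?\<sigma> (Var i) = Var i \<and> subst ?\<tau> (Var i) = Var i"
      if "i \<in> ?X" for i
      using that by (auto simp: env5_def x_def y_def z_def intro: terms.Var)
    show "env5 (Var 0) (Var 1) (Var 2) (Var 4) (Var 3) i \<in> terms Sg ?Y \<and>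
        subst ?\<sigma> (env5 (Var 0) (Var 1) (Var 2) (Var 4) (Var 3) i) = ?\<tau> i \<and>
        subst ?\<tau> (env5 (Var 0) (Var 1) (Var 2) (Var 4) (Var 3) i) = ?\<sigma> i" for i
      by (auto simp: env5_def intro: terms.Var)
  qed
  have "(?c x, ?c z) \<in> \<alpha>"
    unfolding \<alpha>_iff[OF xyz(1,3)]
    by (simp add: x_def z_def env3_def holds_in_variety_def satisfies_def)
  moreover have "(?c x, ?c y) \<in> \<beta>"
    unfolding \<beta>_iff[OF xyz(1,2)]
    by (simp add: x_def y_def env3_def holds_in_variety_def satisfies_def)
  moreover have "(?c y, ?c z) \<in> \<Theta>"
    unfolding \<Theta>_def generated_relation_def
    by (rule image_eqI[of _ _ "Var 3"]) (auto simp: env5_def intro: terms.Var)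
  ultimately have "(?c x, ?c z) \<in> (\<alpha> \<inter> \<beta>) O (\<alpha> \<inter> \<Theta>) O (\<alpha> \<inter> \<beta>)"
    using incl cong tol unfolding tolerance_inclusion_def by blast
  then obtain P Q where PQ: "(?c x, P) \<in> \<alpha> \<inter> \<beta>" "(P, Q) \<in> \<Theta>" "(Q, ?c z) \<in> \<alpha> \<inter> \<beta>"
    by blast
  then obtain t where t: "t \<in> terms Sg ?Y" "P = ?c (subst ?\<sigma> t)" "Q = ?c (subst ?\<tau> t)"
    by (auto simp: \<Theta>_def generated_relation_def)
  have T: "subst ?\<sigma> t \<in> terms Sg ?X" "subst ?\<tau> t \<in> terms Sg ?X"
    using T5 t(1) by (blast intro: subst_closed)+
  have ids:
    "holds_in_variety Sg E (subst (env3 x y x) x) (subst (env3 x y x) (subst ?\<sigma> t))"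
    "holds_in_variety Sg E (subst (env3 x x z) x) (subst (env3 x x z) (subst ?\<sigma> t))"
    "holds_in_variety Sg E (subst (env3 x y x) (subst ?\<tau> t)) (subst (env3 x y x) z)"
    "holds_in_variety Sg E (subst (env3 x x z) (subst ?\<tau> t)) (subst (env3 x x z) z)"
    using PQ(1,3) \<alpha>_iff[OF xyz(1) T(1)] \<beta>_iff[OF xyz(1) T(1)]
      \<alpha>_iff[OF T(2) xyz(3)] \<beta>_iff[OF T(2) xyz(3)]
    unfolding t by blast+
  have "linking_identities A t" if A: "in_variety Sg E A"
    for A :: "('f, ('f, nat) trm set) algebra"
    unfolding linking_identities_def
  proof (intro ballI)
    fix a b assume ab: "a \<in> universe A" "b \<in> universe A"
    \<comment> \<open>The value \<open>b\<close> serves as \<open>y\<close> under \<open>\<alpha>\<close> and as \<open>z\<close> under \<open>\<beta>\<close>.\<close>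
    have "range (env3 a b b) \<subseteq> universe A" using ab by (auto simp: env3_def)
    then have "eval A (env3 a b b) u = eval A (env3 a b b) v" if "holds_in_variety Sg E u v" for u v
      using that A by (simp add: holds_in_variety_def satisfies_def)
    from ids[THEN this] show "eval A (env5 a b a b a) t = a \<and> eval A (env5 a a b a b) t = a \<and>
        eval A (env5 a b a a b) t = a \<and> eval A (env5 a a b b a) t = b"
      by (simp add: eval_subst eval_comp_env3 eval_comp_env5 x_def y_def z_def) (simp add: env3_def)
  qed
  then show thesis using that t(1) by blast
qed

section \<open>The majority term\<close>

text \<open>
  The composition \<open>t(p(x,z,y), q(x,y,z), y, z, q(x,z,y))\<close>. On \<open>(x,z,z)\<close> its first, second and last
  arguments coincide with the uncontrolled value \<open>t(x,z,z,z,z)\<close>, and \<open>t(r,r,z,z,r) = z\<close> removes it.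
\<close>

lemma majority_term_of_linking_term:
  fixes Sg :: "'f signature"
  assumes t: "t \<in> terms Sg {..<5}"
    and link: "\<And>A :: ('f, ('f, nat) trm set) algebra. in_variety Sg E A \<Longrightarrow> linking_identities A t"
  shows "\<exists>m. majority_term Sg E m"
proof
  define x y z :: "('f, nat) trm" where "x = Var 0" and "y = Var 1" and "z = Var 2"
  have xyz: "x \<in> terms Sg {0, 1, 2}" "y \<in> terms Sg {0, 1, 2}" "z \<in> terms Sg {0, 1, 2}"
    by (auto simp: x_def y_def z_def intro: terms.Var)
  let ?m = "subst (env5 (subst (env5 x z y z y) t) (subst (env5 x y z z y) t) y z
    (subst (env5 x z y y z) t)) t"
  have closed: "subst (env5 p q r s w) t \<in> terms Sg {0, 1, 2}"
    if "p \<in> terms Sg {0, 1, 2}" "q \<in> terms Sg {0, 1, 2}" "r \<in> terms Sg {0, 1, 2}"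
      "s \<in> terms Sg {0, 1, 2}" "w \<in> terms Sg {0, 1, 2}"
    for p q r s w :: "('f, nat) trm"
    by (rule subst_closed[OF _ t]) (use that in \<open>simp add: env5_in\<close>)
  have m: "?m \<in> terms Sg {0, 1, 2}" by (intro closed xyz)
  have maj: "eval A (env3 a a b) ?m = a" "eval A (env3 a b a) ?m = a" "eval A (env3 a b b) ?m = b"
    if A: "in_variety Sg E A" and ab: "a \<in> universe A" "b \<in> universe A"
    for A :: "('f, ('f, nat) trm set) algebra" and a b
  proof -
    have ids: "eval A (env5 c d c d c) t = c" "eval A (env5 c c d c d) t = c"
      "eval A (env5 c d c c d) t = c" "eval A (env5 c c d d c) t = d"
      if "c \<in> universe A" "d \<in> universe A" for c d
      using link[OF A] that by (simp_all add: linking_identities_def)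
    have r: "eval A (env5 a b b b b) t \<in> universe A"
      using eval_closed[OF _ _ t, of A "env5 a b b b b"] A ab by (simp add: in_variety_def env5_in)
    have var: "eval A (env3 c d e) x = c" "eval A (env3 c d e) y = d" "eval A (env3 c d e) z = e"
      for c d e by (simp_all add: x_def y_def z_def env3_def)
    show "eval A (env3 a a b) ?m = a" "eval A (env3 a b a) ?m = a" "eval A (env3 a b b) ?m = b"
      using ab r by (simp_all only: eval_subst_env5 var ids)
  qed
  show "majority_term Sg E ?m"
    unfolding majority_term_def Let_def
  proof (intro conjI m)
    have "eval A \<rho> (subst3 ?m (Var 0) (Var 0) (Var 2)) = \<rho> 0"
      "eval A \<rho> (subst3 ?m (Var 0) (Var 1) (Var 0)) = \<rho> 0"
      "eval A \<rho> (subst3 ?m (Var 0) (Var 2) (Var 2)) = \<rho> 2"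
      if "in_variety Sg E A" "range \<rho> \<subseteq> universe A"
      for A :: "('f, ('f, nat) trm set) algebra" and \<rho>
    proof -
      have \<rho>: "\<rho> i \<in> universe A" for i using that(2) by blast
      show "eval A \<rho> (subst3 ?m (Var 0) (Var 0) (Var 2)) = \<rho> 0"
        "eval A \<rho> (subst3 ?m (Var 0) (Var 1) (Var 0)) = \<rho> 0"
        "eval A \<rho> (subst3 ?m (Var 0) (Var 2) (Var 2)) = \<rho> 2"
        unfolding eval_subst3 eval.simps(1) using maj[OF that(1) \<rho> \<rho>] by blast+
    qed
    then show "holds_in_variety Sg E (subst3 ?m (Var 0) (Var 0) (Var 2)) (Var 0)"
      "holds_in_variety Sg E (subst3 ?m (Var 0) (Var 1) (Var 0)) (Var 0)"
      "holds_in_variety Sg E (subst3 ?m (Var 0) (Var 2) (Var 2)) (Var 2)"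
      unfolding holds_in_variety_def satisfies_def eval.simps(1) by simp_all
  qed
qed

theorem theorem2p1:
  fixes Sg :: "'f signature"
    and E :: "(('f, nat) trm \<times> ('f, nat) trm) set"
  assumes "identities Sg E"
  shows "((\<forall>A :: ('f, ('f, nat) trm set) algebra.
             in_variety Sg E A \<longrightarrow> tolerance_inclusion Sg A)
           \<longrightarrow> (\<exists>m. majority_term Sg E m))
       \<and> (tolerance_inclusion Sg (free_algebra Sg E {0, 1, 2})
           \<longrightarrow> (\<exists>m. majority_term Sg E m))"
proof -
  have free: "\<exists>m. majority_term Sg E m"
    if "tolerance_inclusion Sg (free_algebra Sg E {0, 1, 2})"
    using linking_term_exists[OF that] majority_term_of_linking_term by metis
  moreover have "in_variety Sg E (free_algebra Sg E {0, 1, 2})"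
    by (rule free_algebra_in_variety[OF assms]) simp
  ultimately show ?thesis by blast
qed

end
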